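(* Let $G$ be a map on an orientable surface of genus $g$, and let $\{B_1,\ldots,B_{2g}\}$ be a set of cycles of $G$, each with a direction of traversal, that forms a basis for the homology. An orientation of the primal-dual completion $\hat G$ of $G$ is a Schnyder orientation if and only if it is a $\bmod_3$-orientation such that $\gamma(B_i)\equiv 0 \pmod 3$ for all $1\le i\le 2g$.
   Context: A map is a graph embedded on an orientable surface so that every face is homeomorphic to an open disk; throughout, maps have no contractible cycles of length 1 or 2. An angle of $G$ is a face corner. An angle labeling is a map $\ell$ from the set of angles to $\mathbb{Z}_3$. Each edge $e$ has four incident angles (one on each side at each extremity). Edge $e$ is of type 0 if these four labels are all equal; of type 1 or 2 if in clockwise order they read $i-1,i,i,i+1$ for some $i$, type 1 if the two angles labeled $i$ are at the same extremity of $e$ and type 2 if they are on the same side of $e$. The labeling is EDGE if every edge is of type 0, 1 or 2. The primal-dual completion $\hat G$ is obtained by embedding $G$ and its dual $G^*$ simultaneously (each dual vertex inside its face, each edge crossing its dual edge exactly once) and making each crossing point a new vertex, called an edge-vertex; vertices of $G$ are primal-vertices, vertices of $G^*$ dual-vertices. Every edge of $\hat G$ joins an edge-vertex (of degree 4) to a primal- or dual-vertex, and each face of $\hat G$ is a quadrangle containing exactly one primal-vertex $v$ and one dual-vertex $f$, corresponding to the angle of $G$ at $v$ in face $f$. An orientation of $\hat G$ is a Schnyder orientation if there is an EDGE angle labeling $\ell$ of $G$ such that every edge of $\hat G$, which separates two faces of $\hat G$ corresponding to angles $a,a'$ of $G$, is oriented from its edge-vertex to its other end if $\ell(a)=\ell(a')$,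 and towards its edge-vertex if $\ell(a)\ne\ell(a')$. An orientation of $\hat G$ is a $\bmod_3$-orientation if every primal- and dual-vertex has outdegree $\equiv 0\pmod 3$ and every edge-vertex has outdegree $\equiv 1 \pmod 3$. For a cycle $C$ of $G$ with a direction of traversal, let $\hat C$ be the corresponding cycle of $\hat G$ (each edge subdivided by its edge-vertex); $\gamma(C)$ is the number of edges of $\hat G$ not in $\hat C$ that are oriented away from a vertex of $\hat C$ and lie on the right of $\hat C$, minus the number of such edges lying on the left of $\hat C$. Homology: fix an arbitrary reference orientation of the edges; a closed walk $W$ has characteristic flow $\phi(W)\in\mathbb{Z}^{E}$ ($\phi(W)_e$ = number of forward traversals minus backward traversals of $e$). Let $\mathbb{F}$ be the subgroup generated by the characteristic flows of the counterclockwise facial walks and $\mathbb{W}$ the subgroup generated by the characteristic flows of closed walks. A set of closed walks is a basis for the homology if their classes generate $\mathbb{W}/\mathbb{F}\cong\mathbb{Z}^{2g}$. *)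

theory Defs
  imports
    "Graph_Theory.Graph_Theory"
    "HOL-Combinatorics.Orbits"
    "HOL-Combinatorics.Cycles"
    "HOL-Algebra.Coset"
    "HOL-Algebra.Generated_Groups"
    "HOL-Algebra.Free_Abelian_Groups"
    "HOL-Library.Numeral_Type"
    "HOL-Number_Theory.Cong"
begin

section \<open>Maps on orientable surfaces\<close>

text \<open>
  Graphs are bidirected multigraphs (loops allowed): an undirected edge is a pair of opposite arcs
  \<open>a\<close>, \<open>arc_rev M a\<close>. A cellular embedding into an oriented surface is given by its
  rotation system: \<open>arc_succ M a\<close> is the arc following \<open>a\<close> in counterclockwise order
  around the tail of \<open>a\<close>.
\<close>

record 'a rotation_system =
  arc_rev :: "'a \<Rightarrow> 'a"
  arc_succ :: "'a \<Rightarrow> 'a"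

locale embedded_graph =
  fin_digraph G + bidirected_digraph G "arc_rev M"
  for G :: "('v, 'a) pre_digraph" and M :: "'a rotation_system" +
  assumes succ_permutes: "arc_succ M permutes arcs G"
    and succ_cyclic: "\<And>v. v \<in> verts G \<Longrightarrow> out_arcs G v \<noteq> {} \<Longrightarrow> cyclic_on (arc_succ M) (out_arcs G v)"
    and connected: "Digraph_Component.connected G"

text \<open>
  The next arc along the boundary of the face on the left of \<open>a\<close>, so the orbits of
  \<open>face_succ M\<close> are the counterclockwise facial walks.
\<close>

definition face_succ :: "'a rotation_system \<Rightarrow> 'a \<Rightarrow> 'a" where
  "face_succ M = Hilbert_Choice.inv (arc_succ M) \<circ> arc_rev M"

definition face_of :: "'a rotation_system \<Rightarrow> 'a \<Rightarrow> 'a set" where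
  "face_of M a = orbit (face_succ M) a"

definition facial_walk :: "'a rotation_system \<Rightarrow> 'a \<Rightarrow> 'a list" where
  "facial_walk M a = support (face_succ M) a"

text \<open>
  The map consisting of a single vertex on the sphere has one face, whose boundary contains no arc.
\<close>

definition faces :: "('v, 'a) pre_digraph \<Rightarrow> 'a rotation_system \<Rightarrow> 'a set set" where
  "faces G M = (if arcs G = {} then {{}} else face_of M ` arcs G)"

definition edge_of :: "'a rotation_system \<Rightarrow> 'a \<Rightarrow> 'a set" where
  "edge_of M a = {a, arc_rev M a}"

definition edges :: "('v, 'a) pre_digraph \<Rightarrow> 'a rotation_system \<Rightarrow> 'a set set" where
  "edges G M = edge_of M ` arcs G"

definition has_genus :: "('v, 'a) pre_digraph \<Rightarrow> 'a rotation_system \<Rightarrow> nat \<Rightarrow> bool" where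
  "has_genus G M g \<longleftrightarrow>
     int (card (verts G)) - int (card (edges G M)) + int (card (faces G M)) = 2 - 2 * int g"

definition closed_walk :: "('v, 'a) pre_digraph \<Rightarrow> 'a list \<Rightarrow> bool" where
  "closed_walk G W \<longleftrightarrow> (\<exists>u. pre_digraph.awalk G u W u)"

text \<open>
  A cycle of the undirected graph with a direction of traversal; the second condition excludes
  the digraph cycle that runs back and forth along a single edge.
\<close>

definition graph_cycle :: "('v, 'a) pre_digraph \<Rightarrow> 'a rotation_system \<Rightarrow> 'a list \<Rightarrow> bool" where
  "graph_cycle G M C \<longleftrightarrow> pre_digraph.cycle G C \<and> (\<forall>a \<in> set C. arc_rev M a \<notin> set C)"

text \<open>
  Homotopy (with fixed ends) of walks in the surface: since all faces are disks, it is generated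
  by removing or inserting spurs and facial walks.
\<close>

inductive homotopy_move :: "('v, 'a) pre_digraph \<Rightarrow> 'a rotation_system \<Rightarrow> 'a list \<Rightarrow> 'a list \<Rightarrow> bool"
  for G M where
  spur: "pre_digraph.awalk G u (xs @ [a, arc_rev M a] @ ys) v
    \<Longrightarrow> homotopy_move G M (xs @ [a, arc_rev M a] @ ys) (xs @ ys)"
| face: "pre_digraph.awalk G u (xs @ facial_walk M a @ ys) v \<Longrightarrow> a \<in> arcs G
    \<Longrightarrow> homotopy_move G M (xs @ facial_walk M a @ ys) (xs @ ys)"

definition contractible :: "('v, 'a) pre_digraph \<Rightarrow> 'a rotation_system \<Rightarrow> 'a list \<Rightarrow> bool" where
  "contractible G M W \<longleftrightarrow> closed_walk G W \<and> equivclp (homotopy_move G M) W []"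

locale surface_map = embedded_graph +
  assumes no_short_contractible_cycles:
    "\<And>C. graph_cycle G M C \<Longrightarrow> length C \<in> {1, 2} \<Longrightarrow> \<not> contractible G M C"

text \<open>
  A set of arcs containing exactly one of the two arcs of each edge.
\<close>

definition is_orientation :: "('v, 'a) pre_digraph \<Rightarrow> 'a rotation_system \<Rightarrow> 'a set \<Rightarrow> bool" where
  "is_orientation G M D \<longleftrightarrow> D \<subseteq> arcs G \<and> (\<forall>a \<in> arcs G. a \<in> D \<longleftrightarrow> arc_rev M a \<notin> D)"


section \<open>Homology\<close>

text \<open>
  Given a reference orientation \<open>R\<close>, the group \<open>\<int>\<^sup>E\<close> is \<open>free_Abelian_group R\<close>.
\<close>

definition char_flow :: "'a rotation_system \<Rightarrow> 'a set \<Rightarrow> 'a list \<Rightarrow> 'a \<Rightarrow>\<^sub>0 int" where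
  "char_flow M R W =
     (\<Sum>a \<in> R. frag_cmul (int (count_list W a) - int (count_list W (arc_rev M a))) (frag_of a))"

definition face_flows :: "('v, 'a) pre_digraph \<Rightarrow> 'a rotation_system \<Rightarrow> 'a set \<Rightarrow> ('a \<Rightarrow>\<^sub>0 int) set" where
  "face_flows G M R = generate (free_Abelian_group R) (char_flow M R ` facial_walk M ` arcs G)"

definition walk_flows :: "('v, 'a) pre_digraph \<Rightarrow> 'a rotation_system \<Rightarrow> 'a set \<Rightarrow> ('a \<Rightarrow>\<^sub>0 int) set" where
  "walk_flows G M R = generate (free_Abelian_group R) (char_flow M R ` {W. closed_walk G W})"

definition walk_group :: "('v, 'a) pre_digraph \<Rightarrow> 'a rotation_system \<Rightarrow> 'a set \<Rightarrow> ('a \<Rightarrow>\<^sub>0 int) monoid" where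
  "walk_group G M R = (free_Abelian_group R)\<lparr>carrier := walk_flows G M R\<rparr>"

definition homology_group ::
    "('v, 'a) pre_digraph \<Rightarrow> 'a rotation_system \<Rightarrow> 'a set \<Rightarrow> ('a \<Rightarrow>\<^sub>0 int) set monoid" where
  "homology_group G M R = walk_group G M R Mod face_flows G M R"

definition homology_class ::
    "('v, 'a) pre_digraph \<Rightarrow> 'a rotation_system \<Rightarrow> 'a set \<Rightarrow> 'a list \<Rightarrow> ('a \<Rightarrow>\<^sub>0 int) set" where
  "homology_class G M R W = face_flows G M R #>\<^bsub>walk_group G M R\<^esub> char_flow M R W"

definition homology_basis ::
    "('v, 'a) pre_digraph \<Rightarrow> 'a rotation_system \<Rightarrow> 'a set \<Rightarrow> 'a list set \<Rightarrow> bool" where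
  "homology_basis G M R \<B> \<longleftrightarrow> (\<forall>W \<in> \<B>. closed_walk G W) \<and>
     generate (homology_group G M R) (homology_class G M R ` \<B>) = carrier (homology_group G M R)"


section \<open>EDGE angle labelings\<close>

text \<open>
  The angle at the tail of \<open>a\<close> between \<open>a\<close> and \<open>arc_succ M a\<close>, which lies in the face
  on the left of \<open>a\<close>, is represented by \<open>a\<close> itself; labels in \<open>\<int>\<^sub>3\<close> have the numeral
  type \<open>3\<close>. (The angle of a single-vertex map is incident to no edge and is not represented.)

  With \<open>a\<close> drawn upwards, the following are the angles incident to its edge in clockwise order:
  bottom left, top left, top right, bottom right.
\<close>

definition edge_angles :: "'a rotation_system \<Rightarrow> 'a \<Rightarrow> 'a list" where
  "edge_angles M a = [a, Hilbert_Choice.inv (arc_succ M) (arc_rev M a), arc_rev M a, Hilbert_Choice.inv (arc_succ M) a]"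

definition edge_type0 :: "'a rotation_system \<Rightarrow> ('a \<Rightarrow> 3) \<Rightarrow> 'a \<Rightarrow> bool" where
  "edge_type0 M l a \<longleftrightarrow> (\<exists>i. map l (edge_angles M a) = [i, i, i, i])"

text \<open>
  Letting \<open>b\<close> range over both arcs of the edge covers all cyclic shifts of the clockwise reading
  \<open>i - 1, i, i, i + 1\<close> in which the two \<open>i\<close> are at the same extremity (type 1), respectively on
  the same side (type 2).
\<close>

definition edge_type1 :: "'a rotation_system \<Rightarrow> ('a \<Rightarrow> 3) \<Rightarrow> 'a \<Rightarrow> bool" where
  "edge_type1 M l a \<longleftrightarrow>
     (\<exists>i. \<exists>b \<in> edge_of M a. map l (edge_angles M b) = [i - 1, i, i, i + 1])"

definition edge_type2 :: "'a rotation_system \<Rightarrow> ('a \<Rightarrow> 3) \<Rightarrow> 'a \<Rightarrow> bool" where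
  "edge_type2 M l a \<longleftrightarrow>
     (\<exists>i. \<exists>b \<in> edge_of M a. map l (edge_angles M b) = [i, i, i + 1, i - 1])"

definition EDGE_labeling :: "('v, 'a) pre_digraph \<Rightarrow> 'a rotation_system \<Rightarrow> ('a \<Rightarrow> 3) \<Rightarrow> bool" where
  "EDGE_labeling G M l \<longleftrightarrow>
     (\<forall>a \<in> arcs G. edge_type0 M l a \<or> edge_type1 M l a \<or> edge_type2 M l a)"


section \<open>The primal-dual completion\<close>

datatype ('v, 'a) pd_vertex = Primal 'v | Dual "'a set" | EdgeV "'a set"

text \<open>
  For each arc \<open>a\<close> of \<open>G\<close> the completion has one edge between the tail of \<open>a\<close> and the
  edge-vertex of \<open>a\<close> (arcs \<open>PE a\<close>, \<open>EP a\<close>), and one between the face on the left of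
  \<open>a\<close> and the edge-vertex of \<open>a\<close> (arcs \<open>DE a\<close>, \<open>ED a\<close>); the first letter names the
  type of the tail, the second that of the head.
\<close>

datatype 'a pd_arc = PE (base: 'a) | EP (base: 'a) | DE (base: 'a) | ED (base: 'a)

primrec pd_tail :: "('v, 'a) pre_digraph \<Rightarrow> 'a rotation_system \<Rightarrow> 'a pd_arc \<Rightarrow> ('v, 'a) pd_vertex" where
  "pd_tail G M (PE a) = Primal (tail G a)"
| "pd_tail G M (EP a) = EdgeV (edge_of M a)"
| "pd_tail G M (DE a) = Dual (face_of M a)"
| "pd_tail G M (ED a) = EdgeV (edge_of M a)"

primrec pd_flip :: "'a pd_arc \<Rightarrow> 'a pd_arc" where
  "pd_flip (PE a) = EP a"
| "pd_flip (EP a) = PE a"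
| "pd_flip (DE a) = ED a"
| "pd_flip (ED a) = DE a"

text \<open>
  Counterclockwise around the edge-vertex of \<open>a\<close>, with \<open>a\<close> drawn upwards: down \<open>EP a\<close>,
  right \<open>ED (arc_rev M a)\<close>, up \<open>EP (arc_rev M a)\<close>, left \<open>ED a\<close>.
\<close>

primrec pd_next :: "'a rotation_system \<Rightarrow> 'a pd_arc \<Rightarrow> 'a pd_arc" where
  "pd_next M (PE a) = PE (arc_succ M a)"
| "pd_next M (DE a) = DE (face_succ M a)"
| "pd_next M (EP a) = ED (arc_rev M a)"
| "pd_next M (ED a) = EP a"

definition pd_graph :: "('v, 'a) pre_digraph \<Rightarrow> 'a rotation_system \<Rightarrow> (('v, 'a) pd_vertex, 'a pd_arc) pre_digraph" where
  "pd_graph G M =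
     \<lparr> verts = Primal ` verts G \<union> Dual ` faces G M \<union> EdgeV ` edges G M,
       arcs = {x. base x \<in> arcs G},
       tail = pd_tail G M,
       head = pd_tail G M \<circ> pd_flip \<rparr>"

definition pd_map :: "('v, 'a) pre_digraph \<Rightarrow> 'a rotation_system \<Rightarrow> 'a pd_arc rotation_system" where
  "pd_map G M =
     \<lparr> arc_rev = (\<lambda>x. if base x \<in> arcs G then pd_flip x else x),
       arc_succ = (\<lambda>x. if base x \<in> arcs G then pd_next M x else x) \<rparr>"

text \<open>
  The angle of \<open>G\<close> corresponding to a face \<open>Q\<close> of the completion: the boundary of \<open>Q\<close>,
  traversed with \<open>Q\<close> on the left, leaves its unique primal-vertex along \<open>PE a\<close>, and its corner
  at this vertex is the one between \<open>PE a\<close> and \<open>PE (arc_succ M a)\<close>.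
\<close>

definition angle_of_face :: "'a pd_arc set \<Rightarrow> 'a" where
  "angle_of_face Q = (THE a. PE a \<in> Q)"


section \<open>Schnyder orientations and mod-3 orientations\<close>

definition schnyder_orientation ::
    "('v, 'a) pre_digraph \<Rightarrow> 'a rotation_system \<Rightarrow> 'a pd_arc set \<Rightarrow> bool" where
  "schnyder_orientation G M D \<longleftrightarrow>
     is_orientation (pd_graph G M) (pd_map G M) D \<and>
     (\<exists>l. EDGE_labeling G M l \<and>
       (\<forall>e \<in> edges G M. \<forall>x \<in> out_arcs (pd_graph G M) (EdgeV e).
          let y = arc_rev (pd_map G M) x;
              a = angle_of_face (face_of (pd_map G M) x);
              a' = angle_of_face (face_of (pd_map G M) y)
          in (l a = l a' \<longrightarrow> x \<in> D) \<and> (l a \<noteq> l a' \<longrightarrow> y \<in> D)))"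

definition outdeg :: "('v, 'a) pre_digraph \<Rightarrow> 'a set \<Rightarrow> 'v \<Rightarrow> nat" where
  "outdeg G D v = out_degree (G\<lparr>arcs := D\<rparr>) v"

definition mod3_orientation ::
    "('v, 'a) pre_digraph \<Rightarrow> 'a rotation_system \<Rightarrow> 'a pd_arc set \<Rightarrow> bool" where
  "mod3_orientation G M D \<longleftrightarrow>
     is_orientation (pd_graph G M) (pd_map G M) D \<and>
     (\<forall>v \<in> verts G. [outdeg (pd_graph G M) D (Primal v) = 0] (mod 3)) \<and>
     (\<forall>f \<in> faces G M. [outdeg (pd_graph G M) D (Dual f) = 0] (mod 3)) \<and>
     (\<forall>e \<in> edges G M. [outdeg (pd_graph G M) D (EdgeV e) = 1] (mod 3))"

text \<open>
  The elements strictly between \<open>a\<close> and the next occurrence of \<open>b\<close> in the sequence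
  \<open>a, f a, f (f a), \<dots>\<close>.
\<close>

definition between :: "('a \<Rightarrow> 'a) \<Rightarrow> 'a \<Rightarrow> 'a \<Rightarrow> 'a set" where
  "between f a b = {(f ^^ n) a | n. 0 < n \<and> (\<forall>m \<in> {1..n}. (f ^^ m) a \<noteq> b)}"

text \<open>
  The arcs leaving a cycle \<open>P\<close> to its right and to its left: at the vertex between consecutive
  arcs \<open>p\<close> and \<open>q\<close> of \<open>P\<close>, they are those met when turning counterclockwise from
  \<open>arc_rev M p\<close> to \<open>q\<close>, respectively from \<open>q\<close> to \<open>arc_rev M p\<close>.
  Both ends are excluded, so no arc of an edge of the cycle occurs.
\<close>

definition right_arcs :: "'a rotation_system \<Rightarrow> 'a list \<Rightarrow> 'a set" where
  "right_arcs M P = (\<Union>i<length P.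
     between (arc_succ M) (arc_rev M (P ! i)) (P ! (Suc i mod length P)))"

definition left_arcs :: "'a rotation_system \<Rightarrow> 'a list \<Rightarrow> 'a set" where
  "left_arcs M P = (\<Union>i<length P.
     between (arc_succ M) (P ! (Suc i mod length P)) (arc_rev M (P ! i)))"

definition pd_cycle :: "'a rotation_system \<Rightarrow> 'a list \<Rightarrow> 'a pd_arc list" where
  "pd_cycle M C = concat (map (\<lambda>a. [PE a, EP (arc_rev M a)]) C)"

definition gamma ::
    "('v, 'a) pre_digraph \<Rightarrow> 'a rotation_system \<Rightarrow> 'a pd_arc set \<Rightarrow> 'a list \<Rightarrow> int" where
  "gamma G M D C =
     int (card (D \<inter> right_arcs (pd_map G M) (pd_cycle M C))) -
     int (card (D \<inter> left_arcs (pd_map G M) (pd_cycle M C)))"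

end

theory Submission
  imports Defs
begin

text \<open>
  Write \<open>\<sigma>\<close>, \<open>\<rho>\<close>, \<open>\<phi>\<close> for \<open>arc_succ M\<close>, \<open>arc_rev M\<close>, \<open>face_succ M\<close>, and let
  \<open>p a\<close>, \<open>d a\<close> in \<open>\<int>\<^sub>3\<close> indicate whether \<open>PE a\<close>, \<open>DE a\<close> belong to the orientation.
  Clockwise around an edge the labels of an EDGE labeling grow by 0 or 1 at each step, so the
  orientation is Schnyder iff some \<open>l\<close> satisfies \<open>l (\<sigma> a) - l a = p (\<sigma> a)\<close> and
  \<open>l (\<phi> a) - l a = d a\<close>, i.e. iff the cochain given by \<open>p\<close> and \<open>d\<close> is exact. The mod-3 conditions
  at primal-, dual- and edge-vertices say that it is closed.

  In that case integrate \<open>p\<close> around each vertex to a function \<open>\<lambda>\<close> and put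
  \<open>w a = d a + \<lambda> a - \<lambda> (\<phi> a)\<close>. This \<open>w\<close> is antisymmetric under \<open>\<rho>\<close> and sums to zero along facial
  walks, hence is defined on homology classes, and the cochain is exact iff \<open>w\<close> sums to zero along
  all closed walks, equivalently along a homology basis. Following a cycle \<open>C\<close> on its left gives
  \<open>\<Sum>\<^sub>C w = |C| - L\<close> and on its right \<open>\<Sum>\<^sub>C w = R - |C|\<close>, where \<open>L\<close> and \<open>R\<close> count the arcs
  leaving \<open>C\<close> on either side; so \<open>\<gamma> C = R - L = 2 \<Sum>\<^sub>C w\<close>.
\<close>

section \<open>Potentials\<close>

text \<open>Partial sums of \<open>p\<close> along the cycle, started at 0, close up because the
  total over \<open>S\<close> vanishes.\<close>

lemma cyclic_potential:
  fixes p :: "'a \<Rightarrow> 'b::ab_group_add"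
  assumes cyc: "cyclic_on f S" and sum0: "sum p S = 0"
  shows "\<exists>q. \<forall>x\<in>S. q (f x) - q x = p (f x)"
proof -
  from cyc obtain s where s: "s \<in> orbit f s" "S = orbit f s"
    by (auto simp: cyclic_on_def)
  define N where "N = funpow_dist1 f s s"
  let ?h = "\<lambda>n. (f ^^ n) s"
  have inj: "inj_on ?h {0..<N}" and S: "S = ?h ` {0..<N}" and N: "?h N = s" "0 < N"
    using inj_on_funpow_dist1[OF s(1)] orbit_conv_funpow_dist1[OF s(1)] funpow_dist1_prop[OF s(1)]
    by (simp_all only: N_def s(2) zero_less_Suc)
  define q where "q x = (\<Sum>j<the_inv_into {0..<N} ?h x. p (?h (Suc j)))" for x
  have q: "q (?h k) = (\<Sum>j<k. p (?h (Suc j)))" if "k < N" for k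
    using the_inv_into_f_f[OF inj, of k] that by (simp add: q_def)
  have total: "(\<Sum>j<N. p (?h (Suc j))) = 0"
  proof -
    have "(\<Sum>j<N. p (?h (Suc j))) = (\<Sum>j<Suc N. p (?h j)) - p s"
      by (subst sum.lessThan_Suc_shift) simp
    also have "\<dots> = (\<Sum>j<N. p (?h j))" using N(1) by simp
    also have "\<dots> = sum p S" unfolding S sum.reindex[OF inj] by (simp add: atLeast0LessThan)
    finally show ?thesis using sum0 by simp
  qed
  have "q (f x) - q x = p (f x)" if "x \<in> S" for x
  proof -
    from that S obtain k where k: "k < N" "x = ?h k" by auto
    show ?thesis
    proof (cases "Suc k < N")
      case True
      then show ?thesis using q[of k] q[of "Suc k"] k by simp
    next
      \<comment> \<open>The last step returns to \<open>s\<close>, where \<open>q\<close> is 0;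
        \<open>total\<close> accounts for this jump.\<close>
      case False
      with k have "N = Suc k" by simp
      moreover have "f x = s" using N(1) k \<open>N = Suc k\<close> by simp
      moreover have "q s = 0" using q[of 0] N(2) by simp
      ultimately show ?thesis using q[of k] k total by (simp add: minus_equation_iff add_eq_0_iff)
    qed
  qed
  then show ?thesis by blast
qed

text \<open>The orbits are integrated one at a time. The solutions are glued by using, at each
  element, the solution attached to a representative of its orbit.\<close>

lemma permutes_potential:
  fixes p :: "'a \<Rightarrow> 'b::ab_group_add"
  assumes "f permutes A" "finite A" and sum0: "\<And>a. a \<in> A \<Longrightarrow> sum p (orbit f a) = 0"
  shows "\<exists>q. \<forall>a\<in>A. q (f a) - q a = p (f a)"
proof -
  have "\<exists>q. \<forall>x\<in>orbit f a. q (f x) - q x = p (f x)" if "a \<in> A" for a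
    using cyclic_potential[OF cyclic_on_orbit[OF assms(1,2)] sum0[OF that]] .
  then obtain Q where Q: "\<And>a x. a \<in> A \<Longrightarrow> x \<in> orbit f a \<Longrightarrow> Q a (f x) - Q a x = p (f x)"
    by metis
  have perm: "permutation f" using assms(1,2) by (auto simp: permutation_permutes)
  \<comment> \<open>The choice depends only on the orbit as a set, hence agrees for \<open>a\<close>
    and \<open>f a\<close>.\<close>
  define r where "r a = (SOME x. x \<in> orbit f a)" for a
  have "Q (r (f a)) (f a) - Q (r a) a = p (f a)" if "a \<in> A" for a
  proof -
    have r: "r a \<in> orbit f a" unfolding r_def using orbit_nonempty some_in_eq by metis
    have "r (f a) = r a" by (simp add: r_def permutation_orbit_step[OF perm])
    moreover have "r a \<in> A" using r permutes_orbit_subset[OF assms(1) that] by blast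
    moreover have "a \<in> orbit f (r a)"
      using r orbit_swap permutation_self_in_orbit[OF perm] by metis
    ultimately show ?thesis using Q by metis
  qed
  then show ?thesis by (intro exI[of _ "\<lambda>a. Q (r a) a"]) blast
qed

text \<open>Describes \<open>between\<close> by the first time at which \<open>b\<close> is hit, so
  that sums over it can be reindexed by the number of steps.\<close>

lemma between_conv_funpow_dist1:
  assumes "b \<in> orbit f a"
  shows "between f a b = (\<lambda>n. (f ^^ n) a) ` {1..<funpow_dist1 f a b}"
proof -
  let ?N = "funpow_dist1 f a b"
  have "(\<forall>m\<in>{1..n}. (f ^^ m) a \<noteq> b) \<longleftrightarrow> n < ?N" for n
  proof
    assume "\<forall>m\<in>{1..n}. (f ^^ m) a \<noteq> b"
    then have "?N \<notin> {1..n}" using funpow_dist1_prop[OF assms] by blast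
    then show "n < ?N" by simp
  next
    assume n: "n < ?N"
    show "\<forall>m\<in>{1..n}. (f ^^ m) a \<noteq> b"
    proof
      fix m assume "m \<in> {1..n}"
      then have "0 < m" "m < ?N" using n by simp_all
      then show "(f ^^ m) a \<noteq> b" by (rule funpow_dist1_least)
    qed
  qed
  then show ?thesis by (auto simp: between_def)
qed

lemma between_subset_orbit: "between f a b \<subseteq> orbit f a"
  by (auto simp: between_def orbit_altdef)

text \<open>As \<open>between\<close> omits both ends, the sum telescopes from \<open>a\<close> to
  the predecessor \<open>c\<close> of \<open>b\<close>.\<close>

lemma sum_between:
  fixes q :: "'a \<Rightarrow> 'b::ab_group_add"
  assumes b: "b \<in> orbit f a" and step: "\<And>x. x \<in> insert a (orbit f a) \<Longrightarrow> q (f x) - q x = p (f x)"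
    and c: "f c = b" and inj: "inj f"
  shows "sum p (between f a b) = q c - q a"
proof -
  \<comment> \<open>One less than the first hitting time of \<open>b\<close>: \<open>N\<close> steps
    from \<open>a\<close> lead to \<open>c\<close>.\<close>
  define N where "N = funpow_dist f (f a) b"
  let ?h = "\<lambda>n. (f ^^ n) a"
  have "?h N = c" 
    using funpow_dist1_prop[OF b] c inj by (auto simp: N_def dest: injD)
  have "inj_on ?h {1..<Suc N}"
    using inj_on_funpow_dist1[OF b] unfolding N_def by (rule inj_on_subset) auto
  then have "sum p (between f a b) = (\<Sum>n = 1..<Suc N. p (?h n))"
    by (simp add: between_conv_funpow_dist1[OF b] sum.reindex N_def del: One_nat_def)
  also have "\<dots> = (\<Sum>n<N. p (?h (Suc n)))"
    by (simp only: One_nat_def sum.shift_bounds_Suc_ivl atLeast0LessThan)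
  also have "\<dots> = (\<Sum>n<N. q (?h (Suc n)) - q (?h n))"
  proof (rule sum.cong[OF refl])
    fix n
    have "?h n \<in> insert a (orbit f a)" by (cases "n = 0") (auto simp: orbit_altdef)
    from step[OF this] show "p (?h (Suc n)) = q (?h (Suc n)) - q (?h n)" by simp
  qed
  also have "\<dots> = q (?h N) - q a" using sum_lessThan_telescope[of "\<lambda>n. q (?h n)" N] by simp
  finally show ?thesis using \<open>?h N = c\<close> by simp
qed

text \<open>The potential at a vertex is the sum of \<open>w\<close> along a chosen walk from a
  root.\<close>

lemma (in wf_digraph) closed_walk_potential:
  fixes w :: "'b \<Rightarrow> 'c::ab_group_add"
  assumes "strongly_connected G"
    and closed: "\<And>W. closed_walk G W \<Longrightarrow> sum_list (map w W) = 0"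
  shows "\<exists>q. \<forall>a\<in>arcs G. w a = q (head G a) - q (tail G a)"
proof -
  from assms(1) obtain r where r: "r \<in> verts G" by (auto simp: strongly_connected_def)
  have ex: "\<exists>p. awalk u p v" if "u \<in> verts G" "v \<in> verts G" for u v
    using assms(1) that by (auto simp: strongly_connected_def reachable_awalk)
  define P where "P v = (SOME p. awalk r p v)" for v
  have P: "awalk r (P v) v" if "v \<in> verts G" for v
    unfolding P_def using ex[OF r that] by (rule someI_ex)
  have "w a = sum_list (map w (P (head G a))) - sum_list (map w (P (tail G a)))" if a: "a \<in> arcs G" for a
  proof -
    \<comment> \<open>The return walk \<open>p\<close> closes both the walk through \<open>a\<close>
      and the chosen walk to its head, so the sum over \<open>p\<close> cancels.\<close>
    from ex[OF head_in_verts[OF a] r] obtain p where p: "awalk (head G a) p r" by blast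
    have "awalk r (P (tail G a) @ a # p) r"
      using P[OF tail_in_verts[OF a]] by (rule awalk_appendI) (simp add: a p awalk_Cons_iff)
    moreover have "awalk r (P (head G a) @ p) r"
      using P[OF head_in_verts[OF a]] p by (rule awalk_appendI)
    ultimately have "closed_walk G (P (tail G a) @ a # p)" "closed_walk G (P (head G a) @ p)"
      unfolding closed_walk_def by blast+
    from this[THEN closed] have "sum_list (map w (P (tail G a))) + w a = sum_list (map w (P (head G a)))"
      by (metis (no_types, lifting) add.assoc add_right_cancel list.simps(9) map_append sum_list.Cons sum_list_append)
    then show ?thesis by (simp add: algebra_simps)
  qed
  then show ?thesis by (intro exI[of _ "\<lambda>v. sum_list (map w (P v))"]) blast
qed


section \<open>Homology\<close>

context embedded_graph
begin

lemma face_succ_permutes: "face_succ M permutes arcs G"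
  unfolding face_succ_def
  by (intro permutes_compose arev_permutes_arcs permutes_inv succ_permutes)

lemma permutation_arc_succ: "permutation (arc_succ M)"
  using succ_permutes finite_arcs unfolding permutation_permutes by blast

lemma permutation_face_succ: "permutation (face_succ M)"
  using face_succ_permutes finite_arcs unfolding permutation_permutes by blast

lemma arc_succ_in_arcs [simp]: "arc_succ M a \<in> arcs G \<longleftrightarrow> a \<in> arcs G"
  by (rule permutes_in_image[OF succ_permutes])

lemma face_succ_in_arcs [simp]: "face_succ M a \<in> arcs G \<longleftrightarrow> a \<in> arcs G"
  by (rule permutes_in_image[OF face_succ_permutes])

lemma arc_succ_face_succ [simp]: "arc_succ M (face_succ M a) = arc_rev M a"
  by (simp add: face_succ_def permutes_inverses(1)[OF succ_permutes])

lemma orbit_arc_succ: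
  assumes "a \<in> arcs G"
  shows "orbit (arc_succ M) a = out_arcs G (tail G a)"
  using assms by (intro orbit_cyclic_eq3 succ_cyclic) auto

lemma tail_arc_succ [simp]:
  assumes "a \<in> arcs G"
  shows "tail G (arc_succ M a) = tail G a"
  using orbit.base[of "arc_succ M" a] orbit_arc_succ[OF assms] by auto

lemma tail_face_succ [simp]:
  assumes "a \<in> arcs G"
  shows "tail G (face_succ M a) = head G a"
  using assms tail_arc_succ[of "face_succ M a"] by simp

lemma awalk_face_succ_funpow:
  assumes "a \<in> arcs G"
  shows "awalk (tail G a) (map (\<lambda>i. (face_succ M ^^ i) a) [0..<n]) (tail G ((face_succ M ^^ n) a))"
proof (induction n)
  case 0
  then show ?case using assms by (simp add: awalk_Nil_iff)
next
  case (Suc n)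
  have n: "(face_succ M ^^ n) a \<in> arcs G" using assms by (induction n) auto
  with Suc.IH show ?case
    using awalk_appendI[OF Suc.IH, of "[(face_succ M ^^ n) a]"] by (simp add: awalk_simps)
qed

text \<open>The iterates are listed up to the least power fixing \<open>a\<close>, so the last arc
  ends at the tail of \<open>a\<close>.\<close>

lemma closed_walk_facial_walk:
  assumes "a \<in> arcs G"
  shows "closed_walk G (facial_walk M a)"
  using awalk_face_succ_funpow[OF assms, of "least_power (face_succ M) a"]
    least_power_of_permutation(1)[OF permutation_face_succ, of a]
  by (auto simp: closed_walk_def facial_walk_def)

end

text \<open>A function on arcs acting as a linear functional on flows; \<open>of_int\<close> lets
  integral flows act on values in another ring, such as the integers modulo 3.\<close>

definition flow_pairing :: "'a set \<Rightarrow> ('a \<Rightarrow> 'c::comm_ring_1) \<Rightarrow> ('a \<Rightarrow>\<^sub>0 int) \<Rightarrow> 'c" where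
  "flow_pairing R w x = (\<Sum>a\<in>R. of_int (poly_mapping.lookup x a) * w a)"

lemma flow_pairing_0 [simp]: "flow_pairing R w 0 = 0"
  by (simp add: flow_pairing_def)

lemma flow_pairing_add [simp]: "flow_pairing R w (x + y) = flow_pairing R w x + flow_pairing R w y"
  by (simp add: flow_pairing_def lookup_add distrib_right sum.distrib)

lemma flow_pairing_minus [simp]: "flow_pairing R w (- x) = - flow_pairing R w x"
  by (simp add: flow_pairing_def sum_negf)

lemma lookup_char_flow:
  assumes "finite R"
  shows "poly_mapping.lookup (char_flow M R W) a =
    (if a \<in> R then int (count_list W a) - int (count_list W (arc_rev M a)) else 0)"
proof -
  let ?c = "\<lambda>b. int (count_list W b) - int (count_list W (arc_rev M b))"
  have "poly_mapping.lookup (char_flow M R W) a = (\<Sum>b\<in>R. if a = b then ?c b else 0)"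
    unfolding char_flow_def lookup_sum by (rule sum.cong) (auto simp: lookup_frag_of)
  then show ?thesis using assms by simp
qed

lemma keys_char_flow:
  assumes "finite R"
  shows "Poly_Mapping.keys (char_flow M R W) \<subseteq> R"
proof
  fix a assume "a \<in> Poly_Mapping.keys (char_flow M R W)"
  then have "poly_mapping.lookup (char_flow M R W) a \<noteq> 0" by (rule in_keys_iff[THEN iffD1])
  then show "a \<in> R" by (simp add: lookup_char_flow[OF assms] split: if_splits)
qed

text \<open>Exactly one of \<open>b\<close> and its reverse lies in \<open>R\<close>. The
  contribution is \<open>w b\<close> or \<open>- w (arc_rev M b)\<close>, and these agree by
  antisymmetry.\<close>

lemma (in embedded_graph) flow_pairing_char_flow:
  assumes R: "is_orientation G M R" and W: "set W \<subseteq> arcs G"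
    and anti: "\<And>a. a \<in> arcs G \<Longrightarrow> w (arc_rev M a) = - w a"
  shows "flow_pairing R w (char_flow M R W) = sum_list (map w W)"
  using W
proof (induction W)
  case Nil
  then show ?case by (simp add: char_flow_def)
next
  case (Cons b W)
  have fin: "finite R" using R by (auto simp: is_orientation_def intro: finite_subset[OF _ finite_arcs])
  have b: "b \<in> arcs G" using Cons.prems by simp
  have rev: "b = arc_rev M a \<longleftrightarrow> arc_rev M b = a" for a by auto
  have "flow_pairing R w (char_flow M R (b # W)) = flow_pairing R w (char_flow M R W)
      + ((\<Sum>a\<in>R. if b = a then w a else 0) - (\<Sum>a\<in>R. if arc_rev M b = a then w a else 0))"
    unfolding flow_pairing_def sum.distrib[symmetric] sum_subtractf[symmetric]
    by (rule sum.cong[OF refl]) (auto simp: lookup_char_flow[OF fin] rev algebra_simps)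
  also have "(\<Sum>a\<in>R. if b = a then w a else 0) - (\<Sum>a\<in>R. if arc_rev M b = a then w a else 0) = w b"
  proof -
    have "b \<in> R \<longleftrightarrow> arc_rev M b \<notin> R" using R b unfolding is_orientation_def by blast
    then show ?thesis using anti[OF b] fin by simp
  qed
  finally show ?case using Cons by simp
qed

text \<open>Pairing with \<open>w\<close> is additive and vanishes on face flows, so it is constant
  on homology classes. Vanishing on the basis, it vanishes on all classes the basis
  generates.\<close>

lemma (in embedded_graph) closed_walk_sum_eq_0:
  fixes w :: "'a \<Rightarrow> 'c::comm_ring_1"
  assumes R: "is_orientation G M R"
    and anti: "\<And>a. a \<in> arcs G \<Longrightarrow> w (arc_rev M a) = - w a"
    and facial: "\<And>a. a \<in> arcs G \<Longrightarrow> sum_list (map w (facial_walk M a)) = 0"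
    and basis: "homology_basis G M R \<B>"
    and basis0: "\<And>W. W \<in> \<B> \<Longrightarrow> sum_list (map w W) = 0"
    and W: "closed_walk G W"
  shows "sum_list (map w W) = 0"
proof -
  let ?F = "free_Abelian_group R" and ?H = "walk_group G M R"
    and ?N = "face_flows G M R" and ?\<phi> = "flow_pairing R w"
  have fin: "finite R" using R by (auto simp: is_orientation_def intro: finite_subset[OF _ finite_arcs])
  interpret F: comm_group ?F by (rule abelian_free_Abelian_group)
  note keys = keys_char_flow[OF fin]
  have pairing: "?\<phi> (char_flow M R U) = sum_list (map w U)" if "closed_walk G U" for U
    using that by (intro flow_pairing_char_flow R anti) (auto simp: closed_walk_def)
  have sub: "subgroup (walk_flows G M R) ?F" "subgroup ?N ?F"
    unfolding walk_flows_def face_flows_def using keys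
    by (intro F.generate_is_subgroup; force)+
  have "?N \<subseteq> walk_flows G M R"
    unfolding walk_flows_def face_flows_def
    using closed_walk_facial_walk by (intro F.mono_generate) auto
  then have "subgroup ?N ?H"
    unfolding walk_group_def by (intro F.subgroup_incl sub)
  moreover have "comm_group ?H"
    unfolding walk_group_def
    by (rule group.group_comm_groupI[OF subgroup.subgroup_is_group[OF sub(1)]])
      (simp_all add: add.commute)
  ultimately interpret N: normal ?N ?H by (rule comm_group.subgroup_imp_normal[rotated])
  have N0: "?\<phi> x = 0" if "x \<in> ?N" for x
    using that unfolding face_flows_def
  proof (induction rule: generate.induct)
    case (incl h)
    then show ?case using facial closed_walk_facial_walk by (auto simp: pairing)
  next
    case (inv h)
    then show ?case using facial closed_walk_facial_walk keys by (auto simp: pairing)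
  qed auto
  have classes: "homology_class G M R U \<in> carrier (homology_group G M R)" if "closed_walk G U" for U
    using that by (auto simp: homology_class_def homology_group_def FactGroup_def RCOSETS_def
        walk_group_def walk_flows_def intro: generate.incl)
  \<comment> \<open>In place of a homomorphism on the quotient, all representatives of a coset are
    followed through its generation.\<close>
  have zero: "?\<phi> x = 0" if "X \<in> generate (homology_group G M R) (homology_class G M R ` \<B>)" "x \<in> X" for X x
    using that
  proof (induction arbitrary: x rule: generate.induct)
    case one
    then show ?case by (simp add: homology_group_def FactGroup_def N0)
  next
    case (incl h)
    then obtain B where "B \<in> \<B>" "x \<in> homology_class G M R B" by auto
    with basis basis0 show ?case
      by (auto simp: homology_class_def r_coset_def walk_group_def N0 pairing homology_basis_def)
  next
    case (inv h)
    then obtain B where B: "B \<in> \<B>" "h = homology_class G M R B" by auto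
    then have "closed_walk G B" using basis by (simp add: homology_basis_def)
    then have h: "h \<in> carrier (?H Mod ?N)" using classes B by (simp add: homology_group_def)
    have "h \<subseteq> walk_flows G M R"
      using N.rcosets_carrier[OF N.is_group, of h] h by (simp add: FactGroup_def walk_group_def)
    \<comment> \<open>The inverse of a coset consists of the inverses of its members, which are
      negatives since inversion in the subgroup is that of
      \<open>free_Abelian_group R\<close>.\<close>
    with inv N.inv_FactGroup[OF h] obtain y where y: "y \<in> h" "y \<in> walk_flows G M R" "x = inv\<^bsub>?H\<^esub> y"
      by (auto simp: homology_group_def SET_INV_def)
    have "x = - y"
      using y F.m_inv_consistent[OF sub(1) y(2)] subgroup.subset[OF sub(1)]
      by (auto simp: walk_group_def)
    moreover have "?\<phi> y = 0" using y(1) B basis basis0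
      by (auto simp: homology_class_def r_coset_def walk_group_def N0 pairing homology_basis_def)
    ultimately show ?case by simp
  next
    case (eng h1 h2)
    then show ?case by (auto simp: homology_group_def FactGroup_def set_mult_def walk_group_def)
  qed
  \<comment> \<open>This makes the flow of \<open>W\<close> a representative of its own
    class.\<close>
  have "0 \<in> ?N" using subgroup.one_closed[OF sub(2)] by simp
  then have "char_flow M R W \<in> homology_class G M R W"
    by (force simp: homology_class_def r_coset_def walk_group_def)
  moreover have "homology_class G M R W \<in> generate (homology_group G M R) (homology_class G M R ` \<B>)"
    using classes[OF W] basis by (simp add: homology_basis_def)
  ultimately show ?thesis using zero pairing[OF W] by simp
qed


section \<open>The primal-dual completion\<close>

lemma exhaust_mod3: "(x::3) = 0 \<or> x = 1 \<or> x = 2"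
proof (cases x)
  case (of_int z)
  then have "z = 0 \<or> z = 1 \<or> z = 2" by auto
  with of_int show ?thesis by auto
qed

lemma ex_mod3_iff: "(\<exists>i::3. P i) \<longleftrightarrow> P 0 \<or> P 1 \<or> P 2"
  using exhaust_mod3 by metis

lemma cong_mod3_iff: "[x = y] (mod 3) \<longleftrightarrow> (of_int x :: 3) = of_int y"
  by (simp add: of_int_eq_iff_cong_CHAR)

lemma cong_mod3_nat_iff: "[x = y] (mod 3) \<longleftrightarrow> (of_nat x :: 3) = of_nat y"
  using cong_mod3_iff[of "int x" "int y"] cong_int_iff[of x y 3] by simp

text \<open>The four steps around the edge add up to 0, so if each is 0 or 1, then none or exactly
  three of them are 1. With none the type is 0; otherwise the single zero step joins angles at one
  extremity (type 1) or on one side (type 2).\<close>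

lemma edge_labels_iff:
  fixes x0 x1 x2 x3 :: 3
  shows "(\<exists>i. [x0, x1, x2, x3] = [i, i, i, i]) \<or>
    (\<exists>i. [x0, x1, x2, x3] = [i - 1, i, i, i + 1] \<or> [x2, x3, x0, x1] = [i - 1, i, i, i + 1]) \<or>
    (\<exists>i. [x0, x1, x2, x3] = [i, i, i + 1, i - 1] \<or> [x2, x3, x0, x1] = [i, i, i + 1, i - 1]) \<longleftrightarrow>
    x1 - x0 \<in> {0, 1} \<and> x2 - x1 \<in> {0, 1} \<and> x3 - x2 \<in> {0, 1} \<and> x0 - x3 \<in> {0, 1}"
  unfolding ex_mod3_iff list.inject insert_iff empty_iff
  using exhaust_mod3[of x0] exhaust_mod3[of x1] exhaust_mod3[of x2] exhaust_mod3[of x3]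
  by (elim disjE; hypsubst; simp)

lemma orbit_4cycle:
  assumes "f a = b" "f b = c" "f c = d" "f d = a"
  shows "orbit f a = {a, b, c, d}"
proof
  show "orbit f a \<subseteq> {a, b, c, d}"
  proof
    fix x assume "x \<in> orbit f a"
    then show "x \<in> {a, b, c, d}" by induction (use assms in auto)
  qed
  show "{a, b, c, d} \<subseteq> orbit f a"
    using orbit.base[of f a] orbit.step[of _ f a] assms by (metis empty_subsetI insert_subset)
qed

text \<open>This is the turn at an edge-vertex, where a cycle passing straight through leaves one
  arc on each side.\<close>

lemma between_single:
  assumes "f a = c" "f c = b" "c \<noteq> b"
  shows "between f a b = {c}"
proof -
  have "(0 < n \<and> (\<forall>m\<in>{1..n}. (f ^^ m) a \<noteq> b)) \<longleftrightarrow> n = 1" for n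
  proof
    assume n: "0 < n \<and> (\<forall>m\<in>{1..n}. (f ^^ m) a \<noteq> b)"
    moreover have "(f ^^ 2) a = b" using assms by (simp add: numeral_2_eq_2)
    ultimately have "2 \<notin> {1..n}" by blast
    with n show "n = 1" by simp
  next
    assume "n = 1"
    then show "0 < n \<and> (\<forall>m\<in>{1..n}. (f ^^ m) a \<noteq> b)" using assms by simp
  qed
  then show ?thesis using assms(1) by (simp add: between_def)
qed

lemma sum_orbit_shift:
  fixes q :: "'a \<Rightarrow> 'b::comm_monoid_add"
  assumes "permutation f"
  shows "(\<Sum>x\<in>orbit f a. q (f x)) = sum q (orbit f a)"
proof (rule sum.reindex_bij_betw)
  have "f ` orbit f a = orbit f a"
    using orbit_inverse[OF permutation_self_in_orbit[OF assms], where g' = f and f = f]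
    by (simp add: permutation_orbit_step[OF assms])
  moreover have "inj f" using assms by (simp add: permutation bij_is_inj)
  ultimately show "bij_betw f (orbit f a) (orbit f a)"
    by (auto simp: bij_betw_def intro: inj_on_subset)
qed

lemma sum_cyclic_shift:
  fixes h :: "nat \<Rightarrow> 'b::comm_monoid_add"
  shows "(\<Sum>i<n. h (Suc i mod n)) = (\<Sum>i<n. h i)"
proof (cases n)
  case (Suc m)
  have "(\<Sum>i<Suc m. h (Suc i mod Suc m)) = (\<Sum>i<m. h (Suc i)) + h 0"
    by (simp add: sum.lessThan_Suc)
  also have "\<dots> = (\<Sum>i<Suc m. h i)"
    by (simp only: sum.lessThan_Suc_shift add.commute)
  finally show ?thesis using Suc by simp
qed simp

lemma length_pd_cycle [simp]: "length (pd_cycle M C) = 2 * length C"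
  by (induction C) (simp_all add: pd_cycle_def)

lemma nth_pd_cycle:
  assumes "i < length C"
  shows "pd_cycle M C ! (2 * i) = PE (C ! i)" "pd_cycle M C ! Suc (2 * i) = EP (arc_rev M (C ! i))"
  using assms
  by (induction C arbitrary: i) (auto simp: pd_cycle_def nth_Cons less_Suc_eq_0_disj)

text \<open>In \<open>pd_cycle\<close>, turns of even index take place at edge-vertices and turns of
  odd index at primal-vertices.\<close>

lemma UN_lessThan_double:
  "(\<Union>j<2 * n. A j) = (\<Union>i<n. A (2 * i)) \<union> (\<Union>i<n. A (Suc (2 * i)))"
proof -
  have "\<exists>i<n. j = 2 * i \<or> j = Suc (2 * i)" if "j < 2 * n" for j
    using that by (intro exI[of _ "j div 2"]) auto
  then show ?thesis by fastforce
qed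

section \<open>Faces and edge-vertices of the completion\<close>

context embedded_graph
begin

lemma arc_rev_in_arcs_iff [simp]: "arc_rev M a \<in> arcs G \<longleftrightarrow> a \<in> arcs G"
  by (rule permutes_in_image[OF arev_permutes_arcs])

lemma inj_arc_succ: "inj (arc_succ M)"
  by (rule permutes_inj[OF succ_permutes])

lemma inv_arc_succ [simp]: "Hilbert_Choice.inv (arc_succ M) (arc_succ M a) = a"
  by (rule inv_f_f[OF inj_arc_succ])

lemma inv_arc_succ_eq_face_succ: "Hilbert_Choice.inv (arc_succ M) a = face_succ M (arc_rev M a)"
  by (simp add: face_succ_def)

lemma inj_face_succ: "inj (face_succ M)"
  by (rule permutes_inj[OF face_succ_permutes])

text \<open>Lets the inverse inside \<open>face_succ (pd_map G M)\<close> be evaluated. The two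
  branches of \<open>arc_succ\<close> do not collide because \<open>pd_next\<close> preserves
  whether the base is an arc of \<open>G\<close>.\<close>

lemma inj_pd_succ: "inj (arc_succ (pd_map G M))"
proof (rule injI)
  have base: "base (pd_next M x) \<in> arcs G \<longleftrightarrow> base x \<in> arcs G" for x
    by (cases x) simp_all
  have inj: "x = y" if "pd_next M x = pd_next M y" for x y
    using that
    by (cases x; cases y)
      (simp_all add: inj_eq[OF inj_arc_succ] inj_eq[OF inj_face_succ] arev_eq_iff)
  fix x y assume "arc_succ (pd_map G M) x = arc_succ (pd_map G M) y"
  then show "x = y" using base[of x] base[of y] inj[of x y]
    by (auto simp: pd_map_def split: if_splits)
qed

lemma pd_face_succ:
  assumes "base x \<in> arcs G" "base y \<in> arcs G" "pd_next M y = pd_flip x"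
  shows "face_succ (pd_map G M) x = y"
proof -
  have "arc_succ (pd_map G M) y = arc_rev (pd_map G M) x" using assms by (simp add: pd_map_def)
  then show ?thesis by (metis comp_apply face_succ_def inj_pd_succ inv_f_f)
qed

lemma face_succ_rev_succ [simp]: "face_succ M (arc_rev M (arc_succ M a)) = a"
  by (simp add: face_succ_def)

text \<open>The quadrangle of angle \<open>a\<close>: from the tail of \<open>a\<close> over its
  edge-vertex to the face on its left, and back over the edge-vertex of \<open>arc_succ M a\<close>.
  The reverse of \<open>arc_succ M a\<close> precedes \<open>a\<close> on the facial walk, so it
  belongs to the same dual-vertex.\<close>

lemma pd_face_cycle:
  assumes "a \<in> arcs G"
  shows "face_succ (pd_map G M) (PE a) = ED a"
    "face_succ (pd_map G M) (ED a) = DE (arc_rev M (arc_succ M a))"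
    "face_succ (pd_map G M) (DE (arc_rev M (arc_succ M a))) = EP (arc_succ M a)"
    "face_succ (pd_map G M) (EP (arc_succ M a)) = PE a"
  using assms by (auto intro!: pd_face_succ)

text \<open>Each arc lies on one of the quadrangles above. For \<open>DE a\<close> and
  \<open>EP a\<close> the quadrangle is found by solving for the angle, which gives
  \<open>face_succ M a\<close> and \<open>face_succ M (arc_rev M a)\<close>.\<close>

lemma angle_of_pd_face:
  assumes "a \<in> arcs G"
  shows "angle_of_face (face_of (pd_map G M) (PE a)) = a"
    "angle_of_face (face_of (pd_map G M) (ED a)) = a"
    "angle_of_face (face_of (pd_map G M) (DE a)) = face_succ M a"
    "angle_of_face (face_of (pd_map G M) (EP a)) = Hilbert_Choice.inv (arc_succ M) a"
proof -
  note cyc = pd_face_cycle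
  show "angle_of_face (face_of (pd_map G M) (PE a)) = a"
    using orbit_4cycle[OF cyc(1-4)[OF assms]] by (simp add: angle_of_face_def face_of_def)
  show "angle_of_face (face_of (pd_map G M) (ED a)) = a"
    using orbit_4cycle[OF cyc(2,3,4,1)[OF assms]] by (simp add: angle_of_face_def face_of_def)
  have "face_succ M a \<in> arcs G" using assms by simp
  from orbit_4cycle[OF cyc(3,4,1,2)[OF this]]
  show "angle_of_face (face_of (pd_map G M) (DE a)) = face_succ M a"
    by (simp add: angle_of_face_def face_of_def)
  have "face_succ M (arc_rev M a) \<in> arcs G" using assms by simp
  from orbit_4cycle[OF cyc(4,1,2,3)[OF this]]
  show "angle_of_face (face_of (pd_map G M) (EP a)) = Hilbert_Choice.inv (arc_succ M) a"
    by (simp add: angle_of_face_def face_of_def inv_arc_succ_eq_face_succ)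
qed

lemma edge_of_eq_iff: "edge_of M b = edge_of M a \<longleftrightarrow> b = a \<or> b = arc_rev M a"
  by (auto simp: edge_of_def doubleton_eq_iff)

lemma out_arcs_pd_EdgeV:
  assumes "a \<in> arcs G"
  shows "out_arcs (pd_graph G M) (EdgeV (edge_of M a)) =
    {EP a, EP (arc_rev M a), ED a, ED (arc_rev M a)}"
proof (rule Set.set_eqI)
  fix x
  show "x \<in> out_arcs (pd_graph G M) (EdgeV (edge_of M a)) \<longleftrightarrow>
      x \<in> {EP a, EP (arc_rev M a), ED a, ED (arc_rev M a)}"
    using assms by (cases x) (auto simp: pd_graph_def edge_of_eq_iff)
qed

end


section \<open>Labelings and mod-3 orientations as cochains\<close>

text \<open>With values in \<open>3\<close>, where 0 and 1 are distinct, sums of indicators are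
  outdegrees modulo 3.\<close>

definition out_ind :: "'b set \<Rightarrow> 'b \<Rightarrow> 3" where
  "out_ind D x = of_bool (x \<in> D)"

lemma of_nat_card_Int_eq_sum_out_ind:
  "finite S \<Longrightarrow> of_nat (card (D \<inter> S)) = sum (out_ind D) S"
  by (simp add: out_ind_def sum_of_bool_eq Int_commute)

context embedded_graph
begin

lemma finite_arcs_pd_graph: "finite (arcs (pd_graph G M))"
proof (rule finite_subset)
  show "arcs (pd_graph G M) \<subseteq> PE ` arcs G \<union> EP ` arcs G \<union> DE ` arcs G \<union> ED ` arcs G"
  proof
    fix x assume "x \<in> arcs (pd_graph G M)"
    then show "x \<in> PE ` arcs G \<union> EP ` arcs G \<union> DE ` arcs G \<union> ED ` arcs G"
      by (cases x) (auto simp: pd_graph_def)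
  qed
qed simp

lemma out_ind_flip:
  assumes D: "is_orientation (pd_graph G M) (pd_map G M) D" and a: "a \<in> arcs G"
  shows "EP a \<in> D \<longleftrightarrow> PE a \<notin> D" "ED a \<in> D \<longleftrightarrow> DE a \<notin> D"
    "out_ind D (EP a) = 1 - out_ind D (PE a)" "out_ind D (ED a) = 1 - out_ind D (DE a)"
proof -
  have "x \<in> D \<longleftrightarrow> pd_flip x \<notin> D" if "base x = a" for x
  proof -
    have "x \<in> arcs (pd_graph G M)" "arc_rev (pd_map G M) x = pd_flip x"
      using a that by (simp_all add: pd_graph_def pd_map_def)
    with D show ?thesis unfolding is_orientation_def by metis
  qed
  from this[of "EP a"] this[of "ED a"]
  show "EP a \<in> D \<longleftrightarrow> PE a \<notin> D" "ED a \<in> D \<longleftrightarrow> DE a \<notin> D" by simp_all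
  then show "out_ind D (EP a) = 1 - out_ind D (PE a)" "out_ind D (ED a) = 1 - out_ind D (DE a)"
    by (simp_all add: out_ind_def)
qed

lemma of_nat_outdeg_pd_graph:
  assumes "is_orientation (pd_graph G M) (pd_map G M) D"
  shows "of_nat (outdeg (pd_graph G M) D v) = sum (out_ind D) (out_arcs (pd_graph G M) v)"
proof -
  have "D \<subseteq> arcs (pd_graph G M)" using assms by (simp add: is_orientation_def)
  then have "out_arcs (pd_graph G M\<lparr>arcs := D\<rparr>) v = D \<inter> out_arcs (pd_graph G M) v" by auto
  moreover have "finite (out_arcs (pd_graph G M) v)"
    using finite_arcs_pd_graph by (rule finite_subset[rotated]) auto
  ultimately show ?thesis by (simp add: outdeg_def out_degree_def of_nat_card_Int_eq_sum_out_ind)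
qed

lemma out_arcs_pd_Primal: "out_arcs (pd_graph G M) (Primal v) = PE ` out_arcs G v"
proof (rule Set.set_eqI)
  fix x show "x \<in> out_arcs (pd_graph G M) (Primal v) \<longleftrightarrow> x \<in> PE ` out_arcs G v"
    by (cases x) (auto simp: pd_graph_def)
qed

lemma out_arcs_pd_Dual: "out_arcs (pd_graph G M) (Dual f) = DE ` {b \<in> arcs G. face_of M b = f}"
proof (rule Set.set_eqI)
  fix x show "x \<in> out_arcs (pd_graph G M) (Dual f) \<longleftrightarrow> x \<in> DE ` {b \<in> arcs G. face_of M b = f}"
    by (cases x) (auto simp: pd_graph_def)
qed

lemma arcs_of_face:
  assumes "a \<in> arcs G"
  shows "{b \<in> arcs G. face_of M b = face_of M a} = face_of M a"
proof -
  have "b \<in> arcs G \<and> face_of M b = face_of M a" if "b \<in> face_of M a" for b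
    using that permutes_orbit_subset[OF face_succ_permutes assms]
      orbit_cyclic_eq3[OF cyclic_on_orbit'[OF permutation_face_succ]]
    by (auto simp: face_of_def)
  moreover have "b \<in> face_of M b" for b
    by (simp add: face_of_def permutation_self_in_orbit[OF permutation_face_succ])
  ultimately show ?thesis by blast
qed

text \<open>Closedness of the cochain: around vertices, around faces, and around edges.\<close>

lemma mod3_orientation_iff:
  assumes D: "is_orientation (pd_graph G M) (pd_map G M) D"
  defines "p \<equiv> \<lambda>a. out_ind D (PE a)" and "d \<equiv> \<lambda>a. out_ind D (DE a)"
  shows "mod3_orientation G M D \<longleftrightarrow> (\<forall>a\<in>arcs G. sum p (orbit (arc_succ M) a) = 0 \<and>
    sum d (orbit (face_succ M) a) = 0 \<and> p a + p (arc_rev M a) + d a + d (arc_rev M a) = 0)"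
proof -
  note cong_iff = cong_mod3_nat_iff of_nat_outdeg_pd_graph[OF D]
  have "(\<forall>v\<in>verts G. [outdeg (pd_graph G M) D (Primal v) = 0] (mod 3)) \<longleftrightarrow>
      (\<forall>v\<in>verts G. sum p (out_arcs G v) = 0)"
    by (simp add: cong_iff out_arcs_pd_Primal sum.reindex inj_on_def p_def)
  also have "\<dots> \<longleftrightarrow> (\<forall>a\<in>arcs G. sum p (out_arcs G (tail G a)) = 0)"
  proof
    assume *: "\<forall>a\<in>arcs G. sum p (out_arcs G (tail G a)) = 0"
    \<comment> \<open>A vertex without outgoing arcs has an empty sum, so ranging over arcs covers
      all vertices.\<close>
    have "sum p (out_arcs G v) = 0" for v
    proof (cases "out_arcs G v = {}")
      case False
      then obtain a where "a \<in> out_arcs G v" by blast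
      then have "a \<in> arcs G" "tail G a = v" by simp_all
      with * show ?thesis by blast
    qed simp
    then show "\<forall>v\<in>verts G. sum p (out_arcs G v) = 0" by blast
  qed simp
  also have "\<dots> \<longleftrightarrow> (\<forall>a\<in>arcs G. sum p (orbit (arc_succ M) a) = 0)"
    by (simp add: orbit_arc_succ)
  finally have primal: "(\<forall>v\<in>verts G. [outdeg (pd_graph G M) D (Primal v) = 0] (mod 3)) \<longleftrightarrow>
      (\<forall>a\<in>arcs G. sum p (orbit (arc_succ M) a) = 0)" .
  have "(\<forall>f\<in>faces G M. [outdeg (pd_graph G M) D (Dual f) = 0] (mod 3)) \<longleftrightarrow>
      (\<forall>f\<in>faces G M. sum d {b \<in> arcs G. face_of M b = f} = 0)"
    by (simp add: cong_iff out_arcs_pd_Dual sum.reindex inj_on_def d_def)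
  \<comment> \<open>If \<open>G\<close> has no arcs, its only face contributes an empty sum.\<close>
  also have "\<dots> \<longleftrightarrow> (\<forall>a\<in>arcs G. sum d {b \<in> arcs G. face_of M b = face_of M a} = 0)"
    by (simp add: faces_def)
  also have "\<dots> \<longleftrightarrow> (\<forall>a\<in>arcs G. sum d (orbit (face_succ M) a) = 0)"
    using arcs_of_face by (simp add: face_of_def)
  finally have dual: "(\<forall>f\<in>faces G M. [outdeg (pd_graph G M) D (Dual f) = 0] (mod 3)) \<longleftrightarrow>
      (\<forall>a\<in>arcs G. sum d (orbit (face_succ M) a) = 0)" .
  have "[outdeg (pd_graph G M) D (EdgeV (edge_of M a)) = 1] (mod 3) \<longleftrightarrow>
      p a + p (arc_rev M a) + d a + d (arc_rev M a) = 0" if a: "a \<in> arcs G" for a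
  proof -
    \<comment> \<open>Four distinct arcs leave the edge-vertex, each counting 1 minus the indicator
      of its flip, and 4 equals 1 modulo 3.\<close>
    have "of_nat (outdeg (pd_graph G M) D (EdgeV (edge_of M a))) =
        1 - (p a + p (arc_rev M a) + d a + d (arc_rev M a))"
      using arev_neq[OF a, symmetric] a
      by (simp add: of_nat_outdeg_pd_graph[OF D] out_arcs_pd_EdgeV out_ind_flip[OF D] p_def d_def)
    moreover have "1 - s = 1 \<longleftrightarrow> s = 0" for s :: 3 by (simp add: diff_eq_eq)
    ultimately show ?thesis by (simp only: cong_mod3_nat_iff of_nat_1)
  qed
  then have "(\<forall>e\<in>edges G M. [outdeg (pd_graph G M) D (EdgeV e) = 1] (mod 3)) \<longleftrightarrow>
      (\<forall>a\<in>arcs G. p a + p (arc_rev M a) + d a + d (arc_rev M a) = 0)"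
    by (simp add: edges_def)
  with primal dual D show ?thesis by (auto simp: mod3_orientation_def)
qed

text \<open>Clockwise around its edge, the angles starting with \<open>a\<close> are joined
  alternately by a \<phi>-step and a \<sigma>-step.\<close>

lemma EDGE_labeling_iff:
  "EDGE_labeling G M l \<longleftrightarrow>
    (\<forall>a\<in>arcs G. l (arc_succ M a) - l a \<in> {0, 1} \<and> l (face_succ M a) - l a \<in> {0, 1})"
proof -
  have type: "edge_type0 M l a \<or> edge_type1 M l a \<or> edge_type2 M l a \<longleftrightarrow>
      l (face_succ M a) - l a \<in> {0, 1} \<and> l (arc_rev M a) - l (face_succ M a) \<in> {0, 1} \<and>
      l (face_succ M (arc_rev M a)) - l (arc_rev M a) \<in> {0, 1} \<and>
      l a - l (face_succ M (arc_rev M a)) \<in> {0, 1}" for a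
    unfolding edge_labels_iff[symmetric]
    by (simp add: edge_type0_def edge_type1_def edge_type2_def edge_of_def edge_angles_def
        inv_arc_succ_eq_face_succ)
  show ?thesis
  proof
    assume E: "EDGE_labeling G M l"
    show "\<forall>a\<in>arcs G. l (arc_succ M a) - l a \<in> {0, 1} \<and> l (face_succ M a) - l a \<in> {0, 1}"
    proof
      fix a assume "a \<in> arcs G"
      \<comment> \<open>The \<sigma>-step from \<open>a\<close> is the last step around the edge of
        \<open>arc_succ M a\<close>.\<close>
      then have "a \<in> arcs G" "arc_succ M a \<in> arcs G" by simp_all
      with E type[of a] type[of "arc_succ M a"]
      show "l (arc_succ M a) - l a \<in> {0, 1} \<and> l (face_succ M a) - l a \<in> {0, 1}"
        unfolding EDGE_labeling_def face_succ_rev_succ by blast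
    qed
  next
    assume *: "\<forall>a\<in>arcs G. l (arc_succ M a) - l a \<in> {0, 1} \<and> l (face_succ M a) - l a \<in> {0, 1}"
    show "EDGE_labeling G M l"
      unfolding EDGE_labeling_def type
    proof
      fix a assume "a \<in> arcs G"
      then have "a \<in> arcs G" "arc_rev M a \<in> arcs G" "face_succ M a \<in> arcs G"
        "face_succ M (arc_rev M a) \<in> arcs G" by simp_all
      from this[THEN *[rule_format]]
      show "l (face_succ M a) - l a \<in> {0, 1} \<and> l (arc_rev M a) - l (face_succ M a) \<in> {0, 1} \<and>
        l (face_succ M (arc_rev M a)) - l (arc_rev M a) \<in> {0, 1} \<and>
        l a - l (face_succ M (arc_rev M a)) \<in> {0, 1}"
        by simp
    qed
  qed
qed

text \<open>EDGE restricts each difference of labels to 0 or 1, and the orientation records whether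
  it is nonzero; together they say that it equals the indicator.\<close>

lemma schnyder_orientation_iff:
  assumes D: "is_orientation (pd_graph G M) (pd_map G M) D"
  shows "schnyder_orientation G M D \<longleftrightarrow> (\<exists>l. \<forall>a\<in>arcs G.
    l (arc_succ M a) - l a = out_ind D (PE (arc_succ M a)) \<and> l (face_succ M a) - l a = out_ind D (DE a))"
proof -
  let ?orient = "\<lambda>l x. let y = arc_rev (pd_map G M) x;
              a = angle_of_face (face_of (pd_map G M) x);
              a' = angle_of_face (face_of (pd_map G M) y)
          in (l a = l a' \<longrightarrow> x \<in> D) \<and> (l a \<noteq> l a' \<longrightarrow> y \<in> D)"
  have "(\<forall>e\<in>edges G M. \<forall>x\<in>out_arcs (pd_graph G M) (EdgeV e). ?orient l x) \<longleftrightarrow>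
      (\<forall>a\<in>arcs G. ?orient l (EP (arc_succ M a)) \<and> ?orient l (ED a))" for l :: "'a \<Rightarrow> 3"
  proof -
    \<comment> \<open>Since \<sigma> permutes the arcs, \<open>EP (arc_succ M a)\<close> ranges over
      all arcs of this kind.\<close>
    have "(\<forall>e\<in>edges G M. \<forall>x\<in>out_arcs (pd_graph G M) (EdgeV e). P x) \<longleftrightarrow>
      (\<forall>a\<in>arcs G. P (EP (arc_succ M a)) \<and> P (ED a))" for P
    proof
      assume L: "\<forall>e\<in>edges G M. \<forall>x\<in>out_arcs (pd_graph G M) (EdgeV e). P x"
      show "\<forall>a\<in>arcs G. P (EP (arc_succ M a)) \<and> P (ED a)"
      proof
        fix a assume a: "a \<in> arcs G"
        then have s: "arc_succ M a \<in> arcs G" by simp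
        have "P x" if "b \<in> arcs G" "x \<in> {EP b, ED b}" for b x
          using L that out_arcs_pd_EdgeV[OF that(1)] by (auto simp: edges_def)
        from this[OF a] this[OF s] show "P (EP (arc_succ M a)) \<and> P (ED a)" by blast
      qed
    next
      assume R: "\<forall>a\<in>arcs G. P (EP (arc_succ M a)) \<and> P (ED a)"
      have "P (EP b)" if "b \<in> arcs G" for b
        using R[rule_format, of "face_succ M (arc_rev M b)"] that by simp
      with R show "\<forall>e\<in>edges G M. \<forall>x\<in>out_arcs (pd_graph G M) (EdgeV e). P x"
        by (auto simp: edges_def out_arcs_pd_EdgeV)
    qed
    then show ?thesis .
  qed
  \<comment> \<open>The edge of \<open>PE (arc_succ M a)\<close> separates the angles
    \<open>a\<close> and \<open>arc_succ M a\<close>; that of \<open>DE a\<close> separates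
    \<open>a\<close> and \<open>face_succ M a\<close>.\<close>
  moreover have "?orient l (EP (arc_succ M a)) \<longleftrightarrow> (PE (arc_succ M a) \<in> D \<longleftrightarrow> l (arc_succ M a) \<noteq> l a)"
    and "?orient l (ED a) \<longleftrightarrow> (DE a \<in> D \<longleftrightarrow> l (face_succ M a) \<noteq> l a)"
    if "a \<in> arcs G" for a and l :: "'a \<Rightarrow> 3"
    using that by (auto simp: pd_map_def Let_def angle_of_pd_face[unfolded pd_map_def] out_ind_flip[OF D])
  ultimately have "schnyder_orientation G M D \<longleftrightarrow> (\<exists>l. EDGE_labeling G M l \<and>
      (\<forall>a\<in>arcs G. (PE (arc_succ M a) \<in> D \<longleftrightarrow> l (arc_succ M a) \<noteq> l a) \<and>
        (DE a \<in> D \<longleftrightarrow> l (face_succ M a) \<noteq> l a)))"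
    unfolding schnyder_orientation_def using D by simp
  also have "\<dots> \<longleftrightarrow> (\<exists>l. \<forall>a\<in>arcs G. l (arc_succ M a) - l a = out_ind D (PE (arc_succ M a)) \<and>
      l (face_succ M a) - l a = out_ind D (DE a))"
  proof -
    have "x - y = of_bool b \<longleftrightarrow> x - y \<in> {0, 1} \<and> (b \<longleftrightarrow> x \<noteq> y)" for x y :: 3 and b
      by (cases b) auto
    then show ?thesis unfolding EDGE_labeling_iff out_ind_def by (intro ex_cong1) blast
  qed
  finally show ?thesis .
qed

end


section \<open>The invariant gamma\<close>

context embedded_graph
begin

section \<open>Arcs leaving a cycle on either side\<close>

lemma between_pd_PE:
  assumes "a \<in> arcs G"
  shows "between (arc_succ (pd_map G M)) (PE a) (PE b) = PE ` between (arc_succ M) a b"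
proof -
  have "(arc_succ (pd_map G M) ^^ n) (PE a) = PE ((arc_succ M ^^ n) a) \<and> (arc_succ M ^^ n) a \<in> arcs G" for n
    by (induction n) (use assms in \<open>auto simp: pd_map_def\<close>)
  then show ?thesis by (auto simp: between_def)
qed

lemma between_pd_EP:
  assumes "a \<in> arcs G"
  shows "between (arc_succ (pd_map G M)) (EP a) (EP (arc_rev M a)) = {ED (arc_rev M a)}"
  using assms by (intro between_single) (simp_all add: pd_map_def)

text \<open>At the edge-vertex of an arc \<open>a\<close> of \<open>C\<close>, only the edge to the
  face of \<open>arc_rev M a\<close> is on the right; at primal-vertices the turns are those of
  \<open>C\<close>.\<close>

lemma right_arcs_pd_cycle:
  assumes "set C \<subseteq> arcs G"
  shows "right_arcs (pd_map G M) (pd_cycle M C) =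
    PE ` (\<Union>i<length C. between (arc_succ M) (arc_rev M (C ! i)) (C ! (Suc i mod length C))) \<union>
    ED ` arc_rev M ` set C"
    (is "_ = PE ` (\<Union>i<?n. ?T i) \<union> _")
proof -
  let ?P = "pd_cycle M C"
  let ?B = "\<lambda>j. between (arc_succ (pd_map G M)) (arc_rev (pd_map G M) (?P ! j)) (?P ! (Suc j mod (2 * ?n)))"
  have in_arcs: "C ! i \<in> arcs G" if "i < ?n" for i using assms that by auto
  have "?B (2 * i) = {ED (arc_rev M (C ! i))}" if "i < ?n" for i
    using between_pd_EP[OF in_arcs[OF that]] in_arcs[OF that] that
    by (simp add: nth_pd_cycle) (simp add: pd_map_def)
  moreover have "?B (Suc (2 * i)) = PE ` ?T i" if "i < ?n" for i
  proof -
    \<comment> \<open>The successor of an odd index is the even index of the next arc of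
      \<open>C\<close>, also at the wrap-around.\<close>
    have "Suc (Suc (2 * i)) mod (2 * ?n) = 2 * (Suc i mod ?n)"
      using mult_mod_right[of 2 "Suc i" ?n] by simp
    moreover have "Suc i mod ?n < ?n" using that by (intro mod_less_divisor) linarith
    moreover have "arc_rev (pd_map G M) (EP (arc_rev M (C ! i))) = PE (arc_rev M (C ! i))"
      using in_arcs[OF that] by (simp add: pd_map_def)
    ultimately show ?thesis
      using between_pd_PE[of "arc_rev M (C ! i)"] in_arcs[OF that] that by (simp add: nth_pd_cycle)
  qed
  ultimately have "(\<Union>j<2 * ?n. ?B j) = (\<Union>i<?n. {ED (arc_rev M (C ! i))}) \<union> (\<Union>i<?n. PE ` ?T i)"
    unfolding UN_lessThan_double by simp
  also have "(\<Union>i<?n. {ED (arc_rev M (C ! i))}) = ED ` arc_rev M ` set C"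
    by (auto simp: set_conv_nth)
  finally show ?thesis by (auto simp: right_arcs_def)
qed

lemma left_arcs_pd_cycle:
  assumes "set C \<subseteq> arcs G"
  shows "left_arcs (pd_map G M) (pd_cycle M C) =
    PE ` (\<Union>i<length C. between (arc_succ M) (C ! (Suc i mod length C)) (arc_rev M (C ! i))) \<union>
    ED ` set C"
    (is "_ = PE ` (\<Union>i<?n. ?T i) \<union> _")
proof -
  let ?P = "pd_cycle M C"
  let ?B = "\<lambda>j. between (arc_succ (pd_map G M)) (?P ! (Suc j mod (2 * ?n))) (arc_rev (pd_map G M) (?P ! j))"
  have in_arcs: "C ! i \<in> arcs G" if "i < ?n" for i using assms that by auto
  have "?B (2 * i) = {ED (C ! i)}" if "i < ?n" for i
    using between_pd_EP[of "arc_rev M (C ! i)"] in_arcs[OF that] that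
    by (simp add: nth_pd_cycle) (simp add: pd_map_def)
  moreover have "?B (Suc (2 * i)) = PE ` ?T i" if "i < ?n" for i
  proof -
    have "Suc (Suc (2 * i)) mod (2 * ?n) = 2 * (Suc i mod ?n)"
      using mult_mod_right[of 2 "Suc i" ?n] by simp
    moreover have *: "Suc i mod ?n < ?n" using that by (intro mod_less_divisor) linarith
    moreover have "arc_rev (pd_map G M) (EP (arc_rev M (C ! i))) = PE (arc_rev M (C ! i))"
      using in_arcs[OF that] by (simp add: pd_map_def)
    ultimately show ?thesis
      using between_pd_PE[OF in_arcs[OF *]] that by (simp add: nth_pd_cycle)
  qed
  ultimately have "(\<Union>j<2 * ?n. ?B j) = (\<Union>i<?n. {ED (C ! i)}) \<union> (\<Union>i<?n. PE ` ?T i)"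
    unfolding UN_lessThan_double by simp
  also have "(\<Union>i<?n. {ED (C ! i)}) = ED ` set C"
    by (auto simp: set_conv_nth)
  finally show ?thesis by (auto simp: left_arcs_def)
qed

text \<open>Distinct heads will make the turns at different vertices disjoint; the last property
  keeps each turn inside one rotation.\<close>

lemma graph_cycle_props:
  assumes "graph_cycle G M C"
  shows "set C \<subseteq> arcs G" "distinct C" "distinct (map (head G) C)"
    "\<And>i. i < length C \<Longrightarrow> tail G (C ! (Suc i mod length C)) = head G (C ! i)"
proof -
  from assms obtain u where u: "awalk u C u" "distinct (tl (awalk_verts u C))" "C \<noteq> []"
    by (auto simp: graph_cycle_def cycle_def)
  show "set C \<subseteq> arcs G" using u(1) by auto
  show "distinct C" using u distinct_tl_verts_imp_distinct by blast
  have cas: "cas u C u" using u(1) by auto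
  have "awalk_verts u C = tail G (hd C) # map (head G) C"
    using awalk_verts_conv'[OF cas] u(3) by simp
  then show "distinct (map (head G) C)" using u(2) by simp
  \<comment> \<open>The vertices of the walk are listed in two ways; comparing entries joins each
    head to the next tail.\<close>
  have eq: "map (tail G) C @ [head G (last C)] = tail G (hd C) # map (head G) C"
    using awalk_verts_conv'[OF cas] awalk_verts_conv[of u C] u(3) by simp
  have hd_last: "tail G (hd C) = head G (last C)"
    using u by (cases C) (auto simp: awalk_Cons_iff awalk_verts_conv dest: awlast_if_cas)
  fix i assume i: "i < length C"
  show "tail G (C ! (Suc i mod length C)) = head G (C ! i)"
  proof (cases "Suc i < length C")
    case True
    then show ?thesis using arg_cong[OF eq, of "\<lambda>xs. xs ! Suc i"] by (simp add: nth_append)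
  next
    case False
    with i have "Suc i = length C" by simp
    then have "i = length C - 1" "Suc i mod length C = 0" by simp_all
    then show ?thesis using hd_last u(3) by (simp add: hd_conv_nth last_conv_nth)
  qed
qed

text \<open>Serves both sides of a cycle. Turns at distinct vertices are disjoint, so the count
  splits into one sum per vertex and one term per edge-vertex.\<close>

lemma of_nat_card_side:
  assumes V: "set W \<subseteq> arcs G" "distinct W"
    and heads: "distinct vs" and T: "\<And>i. i < length vs \<Longrightarrow> T i \<subseteq> out_arcs G (vs ! i)"
    and D: "is_orientation (pd_graph G M) (pd_map G M) D"
  shows "of_nat (card (D \<inter> (PE ` (\<Union>i<length vs. T i) \<union> ED ` set W))) =
    (\<Sum>i<length vs. \<Sum>x\<in>T i. out_ind D (PE x)) + sum_list (map (\<lambda>a. 1 - out_ind D (DE a)) W)"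
proof -
  have fin: "finite (T i)" if "i < length vs" for i
    using T[OF that] finite_subset[OF _ finite_arcs] by (auto simp: out_arcs_def)
  have disj: "T i \<inter> T j = {}" if "i < length vs" "j < length vs" "i \<noteq> j" for i j
  proof -
    have "vs ! i \<noteq> vs ! j" using that heads by (simp add: nth_eq_iff_index_eq)
    then have "out_arcs G (vs ! i) \<inter> out_arcs G (vs ! j) = {}" by auto
    with T[OF that(1)] T[OF that(2)] show ?thesis by blast
  qed
  have "of_nat (card (D \<inter> (PE ` (\<Union>i<length vs. T i) \<union> ED ` set W))) =
      sum (out_ind D) (PE ` (\<Union>i<length vs. T i) \<union> ED ` set W)"
    using fin by (intro of_nat_card_Int_eq_sum_out_ind) auto
  also have "\<dots> = sum (out_ind D) (PE ` (\<Union>i<length vs. T i)) + sum (out_ind D) (ED ` set W)"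
    using fin by (intro sum.union_disjoint) auto
  also have "sum (out_ind D) (PE ` (\<Union>i<length vs. T i)) = (\<Sum>x\<in>(\<Union>i<length vs. T i). out_ind D (PE x))"
    by (simp add: sum.reindex inj_on_def)
  also have "\<dots> = (\<Sum>i<length vs. \<Sum>x\<in>T i. out_ind D (PE x))"
    using fin disj by (intro sum.UNION_disjoint) auto
  also have "sum (out_ind D) (ED ` set W) = (\<Sum>a\<in>set W. out_ind D (ED a))"
    by (simp add: sum.reindex inj_on_def)
  also have "\<dots> = (\<Sum>a\<in>set W. 1 - out_ind D (DE a))"
    using V(1) out_ind_flip[OF D] by (intro sum.cong) auto
  also have "\<dots> = sum_list (map (\<lambda>a. 1 - out_ind D (DE a)) W)"
    using V(2) by (rule sum.distinct_set_conv_list)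
  finally show ?thesis .
qed

text \<open>Each turn telescopes to a difference of \<open>lam\<close>; regrouping these by arcs
  turns the right count into the sum of \<open>1 + w\<close> and the left count into that of
  \<open>1 - w\<close>.\<close>

lemma of_int_gamma:
  fixes lam :: "'a \<Rightarrow> 3"
  assumes D: "is_orientation (pd_graph G M) (pd_map G M) D" and C: "graph_cycle G M C"
    and lam: "\<And>a. a \<in> arcs G \<Longrightarrow> lam (arc_succ M a) - lam a = out_ind D (PE (arc_succ M a))"
    and w: "\<And>a. w a = out_ind D (DE a) + lam a - lam (face_succ M a)"
    and anti: "\<And>a. a \<in> arcs G \<Longrightarrow> w (arc_rev M a) = - w a"
  shows "of_int (gamma G M D C) = 2 * sum_list (map w C)"
proof -
  let ?n = "length C"
  let ?R = "\<lambda>i. between (arc_succ M) (arc_rev M (C ! i)) (C ! (Suc i mod ?n))"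
  let ?L = "\<lambda>i. between (arc_succ M) (C ! (Suc i mod ?n)) (arc_rev M (C ! i))"
  note C' = graph_cycle_props[OF C]
  have arcs: "C ! i \<in> arcs G" "arc_rev M (C ! i) \<in> arcs G" if "i < ?n" for i
    using C'(1) that by auto
  have next_arcs: "C ! (Suc i mod ?n) \<in> arcs G" if "i < ?n" for i
    using that by (intro arcs(1) mod_less_divisor) linarith
  have orbits: "orbit (arc_succ M) (arc_rev M (C ! i)) = out_arcs G (head G (C ! i))"
    "orbit (arc_succ M) (C ! (Suc i mod ?n)) = out_arcs G (head G (C ! i))" if "i < ?n" for i
    using orbit_arc_succ[OF arcs(2)[OF that]] orbit_arc_succ[OF next_arcs[OF that]] arcs[OF that] C'(4)[OF that]
    by simp_all
  \<comment> \<open>The \<sigma>-predecessor of \<open>b\<close>, at which the telescoping ends, is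
    \<open>face_succ M (arc_rev M b)\<close>.\<close>
  have sum_turn: "(\<Sum>x\<in>between (arc_succ M) a b. out_ind D (PE x)) = lam (face_succ M (arc_rev M b)) - lam a"
    if "a \<in> arcs G" "b \<in> out_arcs G (tail G a)" for a b
    using that orbit_arc_succ[OF that(1)]
    by (intro sum_between[where p = "\<lambda>x. out_ind D (PE x)" and q = lam]) (auto simp: lam inj_arc_succ)
  have R: "(\<Sum>x\<in>?R i. out_ind D (PE x)) = lam (face_succ M (arc_rev M (C ! (Suc i mod ?n)))) - lam (arc_rev M (C ! i))"
    and L: "(\<Sum>x\<in>?L i. out_ind D (PE x)) = lam (face_succ M (C ! i)) - lam (C ! (Suc i mod ?n))"
    if "i < ?n" for i
    using sum_turn[of "arc_rev M (C ! i)" "C ! (Suc i mod ?n)"] sum_turn[of "C ! (Suc i mod ?n)" "arc_rev M (C ! i)"]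
      arcs[OF that] next_arcs[OF that] C'(4)[OF that] by simp_all
  have sums: "sum_list (map f C) = (\<Sum>i<?n. f (C ! i))" for f :: "'a \<Rightarrow> 3"
    by (simp add: sum_list_sum_nth atLeast0LessThan)
  have "of_nat (card (D \<inter> right_arcs (pd_map G M) (pd_cycle M C))) =
      (\<Sum>i<?n. \<Sum>x\<in>?R i. out_ind D (PE x)) + (\<Sum>i<?n. 1 - out_ind D (DE (arc_rev M (C ! i))))"
  proof -
    have "set (map (arc_rev M) C) \<subseteq> arcs G" "distinct (map (arc_rev M) C)"
      using C'(1,2) by (auto simp: distinct_map)
    moreover have "?R i \<subseteq> out_arcs G (map (head G) C ! i)" if "i < length (map (head G) C)" for i
      using between_subset_orbit orbits(1) that by fastforce
    ultimately show ?thesis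
      using of_nat_card_side[OF _ _ C'(3) _ D, of "map (arc_rev M) C" ?R]
      by (simp add: right_arcs_pd_cycle[OF C'(1)] sum_list_sum_nth atLeast0LessThan)
  qed
  also have "\<dots> = (\<Sum>i<?n. lam (face_succ M (arc_rev M (C ! (Suc i mod ?n))))) -
      (\<Sum>i<?n. lam (arc_rev M (C ! i))) + (\<Sum>i<?n. 1 - out_ind D (DE (arc_rev M (C ! i))))"
    by (simp add: R sum_subtractf)
  \<comment> \<open>The cyclic shift reunites the term for the next arc with the other terms of that
    arc.\<close>
  also have "\<dots> = (\<Sum>i<?n. 1 - w (arc_rev M (C ! i)))"
    unfolding sum_cyclic_shift[of "\<lambda>i. lam (face_succ M (arc_rev M (C ! i)))"]
    by (simp add: w sum.distrib sum_subtractf)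
  also have "\<dots> = (\<Sum>i<?n. 1 + w (C ! i))"
    by (simp add: anti arcs)
  finally have right: "of_nat (card (D \<inter> right_arcs (pd_map G M) (pd_cycle M C))) = (\<Sum>i<?n. 1 + w (C ! i))" .
  have "of_nat (card (D \<inter> left_arcs (pd_map G M) (pd_cycle M C))) =
      (\<Sum>i<?n. \<Sum>x\<in>?L i. out_ind D (PE x)) + (\<Sum>i<?n. 1 - out_ind D (DE (C ! i)))"
  proof -
    have "?L i \<subseteq> out_arcs G (map (head G) C ! i)" if "i < length (map (head G) C)" for i
      using between_subset_orbit orbits(2) that by fastforce
    then show ?thesis
      using of_nat_card_side[OF C'(1,2,3) _ D, of ?L]
      by (simp add: left_arcs_pd_cycle[OF C'(1)] sum_list_sum_nth atLeast0LessThan)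
  qed
  also have "\<dots> = (\<Sum>i<?n. lam (face_succ M (C ! i))) -
      (\<Sum>i<?n. lam (C ! (Suc i mod ?n))) + (\<Sum>i<?n. 1 - out_ind D (DE (C ! i)))"
    by (simp add: L sum_subtractf)
  also have "\<dots> = (\<Sum>i<?n. 1 - w (C ! i))"
    unfolding sum_cyclic_shift[of "\<lambda>i. lam (C ! i)"]
    by (simp add: w sum.distrib sum_subtractf)
  finally have left: "of_nat (card (D \<inter> left_arcs (pd_map G M) (pd_cycle M C))) = (\<Sum>i<?n. 1 - w (C ! i))" .
  show ?thesis
    by (simp add: gamma_def left right sums sum.distrib sum_subtractf)
qed

lemma sum_list_facial_walk:
  fixes w :: "'a \<Rightarrow> 'c::comm_monoid_add"
  shows "sum_list (map w (facial_walk M a)) = sum w (orbit (face_succ M) a)"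
proof -
  have "distinct (facial_walk M a)"
    unfolding facial_walk_def by (rule cycle_of_permutation[OF permutation_face_succ])
  moreover have "set (facial_walk M a) = orbit (face_succ M) a"
    unfolding facial_walk_def support_set[OF permutation_face_succ]
      orbit_altdef_permutation[OF permutation_face_succ] by auto
  ultimately show ?thesis by (metis sum.distinct_set_conv_list)
qed

end

section \<open>The characterization of Schnyder orientations\<close>

theorem theorem24:
  fixes G :: "('v, 'a) pre_digraph"
    and M :: "'a rotation_system"
    and g :: nat
    and R :: "'a set"
    and B :: "nat \<Rightarrow> 'a list"
    and D :: "'a pd_arc set"
  assumes "surface_map G M"
    and "has_genus G M g"
    and "is_orientation G M R"
    and "\<forall>i \<in> {1..2 * g}. graph_cycle G M (B i)"
    and "homology_basis G M R (B ` {1..2 * g})"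
    and "is_orientation (pd_graph G M) (pd_map G M) D"
  shows "schnyder_orientation G M D \<longleftrightarrow>
    mod3_orientation G M D \<and> (\<forall>i \<in> {1..2 * g}. [gamma G M D (B i) = 0] (mod 3))"
proof -
  interpret surface_map G M by fact
  note cycles = assms(4)[rule_format] and D = assms(6)
  let ?p = "\<lambda>a. out_ind D (PE a)" and ?d = "\<lambda>a. out_ind D (DE a)"
  \<comment> \<open>As 2 is invertible modulo 3, \<gamma> vanishes exactly when the sum of
    \<open>w\<close> does.\<close>
  have double: "2 * x = 0 \<longleftrightarrow> x = 0" for x :: 3
    using exhaust_mod3[of x] by auto
  \<comment> \<open>The \<sigma>-steps ending at \<open>a\<close> and \<open>arc_rev M a\<close>
    replace differences of \<open>lam\<close> by \<open>?p\<close>, which reduces the claim to the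
    edge-vertex condition.\<close>
  have anti: "?d (arc_rev M a) + lam (arc_rev M a) - lam (face_succ M (arc_rev M a)) =
      - (?d a + lam a - lam (face_succ M a))"
    if "a \<in> arcs G" "mod3_orientation G M D"
      "\<And>a. a \<in> arcs G \<Longrightarrow> lam (arc_succ M a) - lam a = ?p (arc_succ M a)" for a lam
  proof -
    have "?p a + ?p (arc_rev M a) + ?d a + ?d (arc_rev M a) = 0"
      using that(1,2) mod3_orientation_iff[OF D] by blast
    moreover have "lam (arc_rev M a) - lam (face_succ M a) = ?p (arc_rev M a)"
      "lam a - lam (face_succ M (arc_rev M a)) = ?p a"
      using that(3)[of "face_succ M a"] that(3)[of "face_succ M (arc_rev M a)"] that(1) by simp_all
    ultimately show ?thesis by (simp add: algebra_simps eq_neg_iff_add_eq_0)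
  qed
  have gamma_iff: "[gamma G M D C = 0] (mod 3) \<longleftrightarrow>
      sum_list (map (\<lambda>a. ?d a + lam a - lam (face_succ M a)) C) = 0"
    if "graph_cycle G M C" "mod3_orientation G M D"
      and lam: "\<And>a. a \<in> arcs G \<Longrightarrow> lam (arc_succ M a) - lam a = ?p (arc_succ M a)" for C lam
    using of_int_gamma[OF D that(1) lam refl anti[OF _ that(2) lam]]
    by (simp add: cong_mod3_iff double)
  show ?thesis
  proof
    assume "schnyder_orientation G M D"
    then obtain l where l: "\<And>a. a \<in> arcs G \<Longrightarrow> l (arc_succ M a) - l a = ?p (arc_succ M a)"
      "\<And>a. a \<in> arcs G \<Longrightarrow> l (face_succ M a) - l a = ?d a"
      unfolding schnyder_orientation_iff[OF D] by blast
    have mod3: "mod3_orientation G M D"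
      unfolding mod3_orientation_iff[OF D]
    proof (intro ballI conjI)
      fix a assume a: "a \<in> arcs G"
      have "sum ?p (orbit (arc_succ M) a) = (\<Sum>x\<in>orbit (arc_succ M) a. ?p (arc_succ M x))"
        by (rule sum_orbit_shift[OF permutation_arc_succ, symmetric])
      also have "\<dots> = (\<Sum>x\<in>orbit (arc_succ M) a. l (arc_succ M x) - l x)"
        using l(1) permutes_orbit_subset[OF succ_permutes a] by (intro sum.cong) auto
      finally show "sum ?p (orbit (arc_succ M) a) = 0"
        by (simp add: sum_subtractf sum_orbit_shift[OF permutation_arc_succ])
      have "sum ?d (orbit (face_succ M) a) = (\<Sum>x\<in>orbit (face_succ M) a. l (face_succ M x) - l x)"
        using l(2) permutes_orbit_subset[OF face_succ_permutes a] by (intro sum.cong) auto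
      then show "sum ?d (orbit (face_succ M) a) = 0"
        by (simp add: sum_subtractf sum_orbit_shift[OF permutation_face_succ])
      have "?p a = l a - l (face_succ M (arc_rev M a))" "?p (arc_rev M a) = l (arc_rev M a) - l (face_succ M a)"
        using l(1)[of "face_succ M a"] l(1)[of "face_succ M (arc_rev M a)"] a by simp_all
      moreover have "?d a = l (face_succ M a) - l a"
        "?d (arc_rev M a) = l (face_succ M (arc_rev M a)) - l (arc_rev M a)"
        using l(2)[of a] l(2)[of "arc_rev M a"] a by simp_all
      ultimately show "?p a + ?p (arc_rev M a) + ?d a + ?d (arc_rev M a) = 0" by simp
    qed
    have "[gamma G M D (B i) = 0] (mod 3)" if "i \<in> {1..2 * g}" for i
    proof -
      \<comment> \<open>With the labeling itself in the role of \<open>lam\<close>, the function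
        \<open>w\<close> is zero on every arc.\<close>
      have "\<forall>a\<in>set (B i). ?d a + l a - l (face_succ M a) = 0"
        using graph_cycle_props(1)[OF cycles[OF that]] by (auto simp flip: l(2))
      then have "sum_list (map (\<lambda>a. ?d a + l a - l (face_succ M a)) (B i)) = 0"
        by (induction "B i") (simp_all cong: map_cong)
      then show ?thesis using gamma_iff[OF cycles[OF that] mod3 l(1)] by simp
    qed
    with mod3 show "mod3_orientation G M D \<and> (\<forall>i \<in> {1..2 * g}. [gamma G M D (B i) = 0] (mod 3))"
      by blast
  next
    assume R: "mod3_orientation G M D \<and> (\<forall>i \<in> {1..2 * g}. [gamma G M D (B i) = 0] (mod 3))"
    then have mod3: "mod3_orientation G M D" by blast
    note sums = mod3[unfolded mod3_orientation_iff[OF D], rule_format]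
    have "\<exists>lam. \<forall>a\<in>arcs G. lam (arc_succ M a) - lam a = ?p (arc_succ M a)"
      using sums by (intro permutes_potential[OF succ_permutes finite_arcs]) blast
    then obtain lam where lam: "\<And>a. a \<in> arcs G \<Longrightarrow> lam (arc_succ M a) - lam a = ?p (arc_succ M a)"
      by blast
    define w where "w a = ?d a + lam a - lam (face_succ M a)" for a
    have "\<exists>q. \<forall>a\<in>arcs G. w a = q (head G a) - q (tail G a)"
    proof (rule closed_walk_potential)
      show "strongly_connected G"
        using connected by (rule symmetric_connected_imp_strongly_connected[OF sym_arcs])
      fix W assume W: "closed_walk G W"
      show "sum_list (map w W) = 0"
      proof (rule closed_walk_sum_eq_0[OF assms(3) _ _ assms(5) _ W])
        show "w (arc_rev M a) = - w a" if "a \<in> arcs G" for a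
          unfolding w_def by (rule anti[OF that mod3 lam])
        show "sum_list (map w (facial_walk M a)) = 0" if "a \<in> arcs G" for a
          unfolding sum_list_facial_walk w_def using sums[OF that]
          by (simp add: sum.distrib sum_subtractf sum_orbit_shift[OF permutation_face_succ])
        show "sum_list (map w U) = 0" if "U \<in> B ` {1..2 * g}" for U
          using that gamma_iff[OF cycles mod3 lam] R unfolding w_def by blast
      qed
    qed
    then obtain q where q: "\<And>a. a \<in> arcs G \<Longrightarrow> w a = q (head G a) - q (tail G a)" by blast
    show "schnyder_orientation G M D"
      unfolding schnyder_orientation_iff[OF D]
    \<comment> \<open>A \<sigma>-step keeps the tail, so \<open>q\<close> leaves it unchanged; a
      \<phi>-step moves from tail to head and gains \<open>w a\<close>, the missing difference to
      \<open>?d a\<close>.\<close>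
    proof (intro exI[of _ "\<lambda>a. lam a + q (tail G a)"] ballI conjI)
      fix a assume a: "a \<in> arcs G"
      show "lam (arc_succ M a) + q (tail G (arc_succ M a)) - (lam a + q (tail G a)) = ?p (arc_succ M a)"
        using lam[OF a] a by simp
      show "lam (face_succ M a) + q (tail G (face_succ M a)) - (lam a + q (tail G a)) = ?d a"
        using q[OF a] a by (simp add: w_def algebra_simps)
    qed
  qed
qed

end
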